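(* Let $h$ be a probability density on $\mathbb R$ such that: (i) $h$ is symmetric, positive, bounded, and decreasing on $[0,\infty)$; (ii) for some $c_1>0$, $\kappa\ge0$, $\log(1/h(x))\le c_1(1+\log^{1+\kappa}(1+x))$ for all $x\ge0$; (iii) for some $c_2>0$, $\int_x^\infty h(u)\,du\le c_2/x^2$ for all $x\ge1$. Let $\Pi$ be the prior on $f=(f_k)_{k\ge1}$ under which $f_k=\sigma_k\zeta_k$ with $(\zeta_k)$ i.i.d. of density $h$. (1) Suppose $\sigma_k=k^{-1/2-\alpha}$ with $\alpha>1/2$. For $\beta>0$ let $\varepsilon_n=(\log n)^{\frac{1+(1+\kappa)\beta}{2\beta+1}}n^{-\frac{\beta}{2\beta+1}}$. Then for any $0<\beta\le\alpha$, $L>0$ and $f_0\in\mathcal S^\beta(L)$, for any $d_2>0$ there exists $d_1>0$ sufficiently large such that, for all $n\ge2$, $$\Pi[\|f-f_0\|_2<d_1\varepsilon_n]\ge e^{-d_2n\varepsilon_n^2}.$$ (2) Suppose $\sigma_k=e^{-a(\log k)^{1+\delta}}$ for some $a,\delta>0$. For $\beta>0$ let $\varepsilon_n=(\log n)^{\frac{(1+\kappa)(1+\delta)\beta}{2\beta+1}}n^{-\frac{\beta}{2\beta+1}}$. Then for any $\beta>0$, $L>0$ and $f_0\in\mathcal S^\beta(L)$, for any $d_2>0$ there exists $d_1>0$ sufficiently large such that, for all $n\ge2$, $$\Pi[\|f-f_0\|_2<d_1\varepsilon_n]\ge e^{-d_2n\varepsilon_n^2}.$$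
   Context: Functions $f\in L^2[0,1]$ are identified with their coefficient sequences $(f_k)_{k\ge1}$ on a fixed orthonormal basis of $L^2[0,1]$, so $\|f\|_2^2=\sum_kf_k^2$. The Sobolev-type ball is $\mathcal S^\beta(L)=\{f=(f_k):\ \sum_{k\ge1}k^{2\beta}f_k^2\le L^2\}$. *)

theory Defs
  imports "HOL-Probability.Probability"
begin

text \<open>Functions in \<open>L\<^sup>2[0,1]\<close> are represented by their coefficient sequences \<open>(f k)\<close>, \<open>k \<ge> 1\<close>, on a
  fixed orthonormal basis. Sequences have type \<open>nat \<Rightarrow> real\<close>; the value at index 0 is never used, and a
  series \<open>\<Sum>k\<ge>1. u k\<close> is written \<open>\<Sum>k. u (Suc k)\<close>.\<close>

definition square_summable :: "(nat \<Rightarrow> real) \<Rightarrow> bool" where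
  "square_summable f \<longleftrightarrow> summable (\<lambda>k. (f (Suc k))\<^sup>2)"

definition l2_norm :: "(nat \<Rightarrow> real) \<Rightarrow> real" where
  "l2_norm f = sqrt (\<Sum>k. (f (Suc k))\<^sup>2)"

definition sobolev_ball :: "real \<Rightarrow> real \<Rightarrow> (nat \<Rightarrow> real) set" where
  "sobolev_ball \<beta> L =
     {f. summable (\<lambda>k. real (Suc k) powr (2 * \<beta>) * (f (Suc k))\<^sup>2) \<and>
         (\<Sum>k. real (Suc k) powr (2 * \<beta>) * (f (Suc k))\<^sup>2) \<le> L\<^sup>2}"

definition probability_density :: "(real \<Rightarrow> real) \<Rightarrow> bool" where
  "probability_density h \<longleftrightarrow>
     (\<forall>x. 0 \<le> h x) \<and> integrable lborel h \<and> integral\<^sup>L lborel h = 1"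

text \<open>The law of \<open>(\<sigma> k * \<zeta> k)\<close>, \<open>k \<ge> 1\<close>, for i.i.d. \<open>\<zeta> k\<close> with Lebesgue density \<open>h\<close>.\<close>

definition series_prior :: "(nat \<Rightarrow> real) \<Rightarrow> (real \<Rightarrow> real) \<Rightarrow> (nat \<Rightarrow> real) measure" where
  "series_prior \<sigma> h =
     distr (Pi\<^sub>M {1..} (\<lambda>_. density lborel (\<lambda>x. ennreal (h x)))) (Pi\<^sub>M {1..} (\<lambda>_. borel))
       (\<lambda>\<zeta>. \<lambda>k\<in>{1..}. \<sigma> k * \<zeta> k)"

text \<open>Square summability is part of the event, since \<^const>\<open>suminf\<close> is meaningless on a divergent
  series; a divergent series corresponds to an infinite norm.\<close>

definition small_ball_prob ::
  "(nat \<Rightarrow> real) measure \<Rightarrow> (nat \<Rightarrow> real) \<Rightarrow> real \<Rightarrow> real" where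
  "small_ball_prob P f0 r =
     measure P {f \<in> space P. square_summable (\<lambda>k. f k - f0 k) \<and> l2_norm (\<lambda>k. f k - f0 k) < r}"

definition rate_poly :: "real \<Rightarrow> real \<Rightarrow> nat \<Rightarrow> real" where
  "rate_poly \<kappa> \<beta> n =
     ln (real n) powr ((1 + (1 + \<kappa>) * \<beta>) / (2 * \<beta> + 1)) * real n powr (- \<beta> / (2 * \<beta> + 1))"

definition rate_exp :: "real \<Rightarrow> real \<Rightarrow> real \<Rightarrow> nat \<Rightarrow> real" where
  "rate_exp \<kappa> \<delta> \<beta> n =
     ln (real n) powr ((1 + \<kappa>) * (1 + \<delta>) * \<beta> / (2 * \<beta> + 1)) * real n powr (- \<beta> / (2 * \<beta> + 1))"

end

theory Submission imports Defs "HOL-Real_Asymp.Real_Asymp" begin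

text \<open>
  The small ball contains a product of intervals. Put \<open>\<gamma> = (1 + \<kappa>) (1 + \<delta>)\<close>, with \<open>\<delta> = 0\<close> for the
  polynomial scaling, and cut the coordinates at \<open>Y = c X\<close>, where \<open>X = n \<epsilon>\<^sup>2 / (log n)\<^sup>\<gamma>\<close>. For \<open>k \<le> Y\<close>
  ask for \<open>\<bar>f k - f0 k\<bar> \<le> \<epsilon> / sqrt X\<close>; the lower bound on \<open>h\<close> makes each of these constraints cost at
  most a factor \<open>exp (- C (log n)\<^sup>\<gamma>)\<close>. For \<open>k > Y\<close> ask for \<open>\<bar>\<zeta> k\<bar> \<le> t k\<close> with
  \<open>(t k)\<^sup>2 = M (k / Y) powr (\<alpha> + 1/2)\<close>. Multiplying these probabilities, instead of using a union bound,
  costs only \<open>exp (- C Y / M)\<close>, while the tail of the squared norm stays of order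
  \<open>Y powr (- 2 \<alpha>)\<close>; both need \<open>\<alpha> > 1/2\<close>. Taking \<open>c\<close> small and \<open>M\<close> large makes the total cost at most
  \<open>exp (- d2 n \<epsilon>\<^sup>2)\<close>. The exponential scaling is dominated by a polynomial one with \<open>\<alpha> \<ge> \<beta>\<close>.
\<close>

section \<open>The law of one coordinate, and boxes in the infinite product\<close>

lemma prob_space_density_lborel:
  assumes "probability_density h"
  shows "prob_space (density lborel (\<lambda>x. ennreal (h x)))"
proof (rule prob_spaceI)
  have h: "integrable lborel h" "\<And>x. 0 \<le> h x" "integral\<^sup>L lborel h = 1"
    using assms by (auto simp: probability_density_def)
  then have [measurable]: "h \<in> borel_measurable borel" by auto
  show "emeasure (density lborel (\<lambda>x. ennreal (h x))) (space (density lborel (\<lambda>x. ennreal (h x)))) = 1"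
    using nn_integral_eq_integral[OF h(1)] h(2,3) by (simp add: emeasure_density)
qed

lemma measure_density_lborel:
  assumes "probability_density h" and [measurable]: "A \<in> sets borel"
  shows "measure (density lborel (\<lambda>x. ennreal (h x))) A = (LBINT x:A. h x)"
proof -
  have h: "integrable lborel h" "\<And>x. 0 \<le> h x"
    using assms by (auto simp: probability_density_def)
  then have [measurable]: "h \<in> borel_measurable borel" by auto
  have i: "set_integrable lborel A h"
    unfolding set_integrable_def by (rule integrable_mult_indicator) (use h(1) in auto)
  have "emeasure (density lborel (\<lambda>x. ennreal (h x))) A = (\<integral>\<^sup>+x. ennreal (indicator A x * h x) \<partial>lborel)"
    by (auto simp: emeasure_density indicator_def intro!: nn_integral_cong)
  also have "\<dots> = ennreal (LBINT x:A. h x)"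
    using i h(2) by (subst nn_integral_eq_integral) (auto simp: set_integrable_def set_lebesgue_integral_def)
  finally show ?thesis
    using h(2) by (auto simp: measure_def set_lebesgue_integral_def intro!: integral_nonneg_AE)
qed

text \<open>Independence gives a finite product over the first \<open>n\<close> coordinates. Since
  \<open>q\<close> is nonnegative and summable, all these products are bounded below by one
  constant, and continuity from above along the decreasing events \<open>E n\<close> carries the
  bound to the infinite box.\<close>

lemma measure_PiM_box_ge:
  fixes q :: "nat \<Rightarrow> real"
  assumes "prob_space D"
    and B: "\<And>k. k \<ge> 1 \<Longrightarrow> B k \<in> sets D"
    and p: "\<And>k. k \<ge> 1 \<Longrightarrow> exp (- q k) \<le> measure D (B k)"
    and q: "\<And>k. 0 \<le> q k" "summable (\<lambda>k. q (Suc k))"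
  shows "exp (- (\<Sum>k. q (Suc k))) \<le>
    measure (Pi\<^sub>M {1..} (\<lambda>_. D)) {z \<in> space (Pi\<^sub>M {1..} (\<lambda>_. D)). \<forall>k\<ge>1. z k \<in> B k}"
proof -
  interpret D: prob_space D by fact
  interpret product_prob_space "\<lambda>_. D" "{1::nat..}"
    by standard
  define N where "N = Pi\<^sub>M {1::nat..} (\<lambda>_. D)"
  define E where "E n = {z \<in> space N. \<forall>k\<in>{1..n}. z k \<in> B k}" for n :: nat
  have E_meas: "E n \<in> sets N" for n
  proof -
    have "{z \<in> space N. z k \<in> B k} \<in> sets N" if "k \<in> {1..n}" for k
      using B that unfolding N_def by (intro sets_Collect_single') auto
    then show ?thesis
      unfolding E_def by (intro sets.sets_Collect_finite_All) auto
  qed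
  have E_prob: "measure N (E n) = (\<Prod>k\<in>{1..n}. measure D (B k))" for n
  proof -
    have "emeasure N (E n) = (\<Prod>k\<in>{1..n}. emeasure D (B k))"
      unfolding N_def E_def by (intro emeasure_PiM_Collect) (auto intro: B)
    then show ?thesis
      unfolding N_def emeasure_eq_measure D.emeasure_eq_measure
      by (simp add: prod_ennreal prod_nonneg)
  qed
  have ge: "exp (- (\<Sum>k. q (Suc k))) \<le> measure N (E n)" for n
  proof -
    have "(\<Sum>k\<in>{1..n}. q k) = (\<Sum>k<n. q (Suc k))"
      using sum.shift_bounds_Suc_ivl[of q 0 n]
      by (simp add: lessThan_atLeast0 atLeastLessThanSuc_atLeastAtMost)
    also have "\<dots> \<le> (\<Sum>k. q (Suc k))"
      using q by (intro sum_le_suminf) auto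
    finally have "exp (- (\<Sum>k. q (Suc k))) \<le> exp (\<Sum>k\<in>{1..n}. - q k)"
      by (simp add: sum_negf)
    also have "\<dots> = (\<Prod>k\<in>{1..n}. exp (- q k))"
      by (simp add: exp_sum)
    also have "\<dots> \<le> (\<Prod>k\<in>{1..n}. measure D (B k))"
      by (intro prod_mono) (auto intro: p)
    finally show ?thesis using E_prob by simp
  qed
  have "decseq E"
    by (auto simp: decseq_def E_def)
  then have "(\<lambda>n. measure N (E n)) \<longlonglongrightarrow> measure N (\<Inter>n. E n)"
    using E_meas unfolding N_def by (intro finite_Lim_measure_decseq) auto
  then have "exp (- (\<Sum>k. q (Suc k))) \<le> measure N (\<Inter>n. E n)"
    by (rule LIMSEQ_le_const) (use ge in auto)
  also have "(\<Inter>n. E n) = {z \<in> space N. \<forall>k\<ge>1. z k \<in> B k}"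
    unfolding E_def by fastforce
  finally show ?thesis unfolding N_def .
qed

text \<open>Reduces the small ball to one-dimensional constraints: the box with half-widths
  \<open>r k\<close> around \<open>f0\<close> lies in the ball as soon as the squared half-widths
  sum to less than \<open>\<rho>\<^sup>2\<close>. Costs \<open>q k\<close> and half-widths
  \<open>r k\<close> can then be chosen coordinate by coordinate.\<close>

lemma small_ball_prob_ge:
  fixes q r :: "nat \<Rightarrow> real"
  assumes h: "probability_density h"
    and p: "\<And>k. k \<ge> 1 \<Longrightarrow>
      exp (- q k) \<le> measure (density lborel (\<lambda>x. ennreal (h x))) {x. \<bar>\<sigma> k * x - f0 k\<bar> \<le> r k}"
    and q: "\<And>k. 0 \<le> q k" "summable (\<lambda>k. q (Suc k))" "(\<Sum>k. q (Suc k)) \<le> Q"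
    and r: "summable (\<lambda>k. (r (Suc k))\<^sup>2)" "(\<Sum>k. (r (Suc k))\<^sup>2) < \<rho>\<^sup>2" and "\<rho> > 0"
  shows "exp (- Q) \<le> small_ball_prob (series_prior \<sigma> h) f0 \<rho>"
proof -
  define D where "D = density lborel (\<lambda>x. ennreal (h x))"
  define N where "N = Pi\<^sub>M {1::nat..} (\<lambda>_. D)"
  interpret D: prob_space D
    unfolding D_def by (rule prob_space_density_lborel[OF h])
  interpret product_prob_space "\<lambda>_. D" "{1::nat..}"
    by standard
  have D_sets [measurable_cong]: "sets D = sets borel" by (simp add: D_def)
  define B where "B k = {x. \<bar>\<sigma> k * x - f0 k\<bar> \<le> r k}" for k
  have B: "B k \<in> sets D" for k
    unfolding B_def by measurable
  define g where "g = (\<lambda>\<zeta>. \<lambda>k\<in>{1::nat..}. \<sigma> k * (\<zeta> k :: real))"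
  define T where "T = Pi\<^sub>M {1::nat..} (\<lambda>_. borel :: real measure)"
  have g: "g \<in> measurable N T"
    unfolding g_def N_def T_def by measurable
  define S where "S = {f \<in> space T. square_summable (\<lambda>k. f k - f0 k) \<and> l2_norm (\<lambda>k. f k - f0 k) < \<rho>}"
  have coord: "(\<lambda>f. (f (Suc k) - f0 (Suc k))\<^sup>2) \<in> borel_measurable T" for k
    unfolding T_def
    by (intro borel_measurable_power borel_measurable_diff measurable_component_singleton) auto
  \<comment> \<open>Summability is expressed as the Cauchy property of the partial sums, a countable
    condition; this makes the event measurable, so that its probability can be pulled back along
    \<open>g\<close>.\<close>
  have "{f \<in> space T. square_summable (\<lambda>k. f k - f0 k)} \<in> sets T"
    unfolding square_summable_def summable_iff_convergent Cauchy_convergent_iff[symmetric]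
    by (intro sets_Collect_Cauchy borel_measurable_sum coord)
  moreover have "(\<lambda>f. l2_norm (\<lambda>k. f k - f0 k)) \<in> borel_measurable T"
    unfolding l2_norm_def 
    by (intro measurable_compose[OF _ borel_measurable_sqrt] borel_measurable_suminf coord)
  then have "{f \<in> space T. l2_norm (\<lambda>k. f k - f0 k) < \<rho>} \<in> sets T"
    by measurable
  ultimately have S: "S \<in> sets T"
    unfolding S_def by (intro sets.sets_Collect_conj)
  have prior: "series_prior \<sigma> h = distr N T g"
    by (simp add: series_prior_def N_def T_def g_def D_def)
  have "exp (- Q) \<le> exp (- (\<Sum>k. q (Suc k)))" using q by simp
  also have "\<dots> \<le> measure N {z \<in> space N. \<forall>k\<ge>1. z k \<in> B k}"
    unfolding N_def
    by (rule measure_PiM_box_ge) (use p q B D.prob_space_axioms in \<open>auto simp: B_def D_def\<close>)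
  also have "\<dots> \<le> measure N (g -` S \<inter> space N)"
  proof (rule finite_measure.finite_measure_mono)
    show "finite_measure N" unfolding N_def by unfold_locales
    show "g -` S \<inter> space N \<in> sets N" using g S by (rule measurable_sets)
    show "{z \<in> space N. \<forall>k\<ge>1. z k \<in> B k} \<subseteq> g -` S \<inter> space N"
    proof
      fix z assume "z \<in> {z \<in> space N. \<forall>k\<ge>1. z k \<in> B k}"
      then have z: "z \<in> space N" "\<forall>k\<ge>1. z k \<in> B k" by auto
      have le: "(g z (Suc k) - f0 (Suc k))\<^sup>2 \<le> (r (Suc k))\<^sup>2" for k
      proof (rule abs_le_square_iff[THEN iffD1])
        have "\<bar>\<sigma> (Suc k) * z (Suc k) - f0 (Suc k)\<bar> \<le> r (Suc k)"
          using z(2)[rule_format, of "Suc k"] by (simp add: B_def)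
        then show "\<bar>g z (Suc k) - f0 (Suc k)\<bar> \<le> \<bar>r (Suc k)\<bar>"
          by (simp add: g_def)
      qed
      have sm: "summable (\<lambda>k. (g z (Suc k) - f0 (Suc k))\<^sup>2)"
        by (rule summable_comparison_test'[OF r(1), of 0]) (use le in simp)
      have "(\<Sum>k. (g z (Suc k) - f0 (Suc k))\<^sup>2) \<le> (\<Sum>k. (r (Suc k))\<^sup>2)"
        by (intro suminf_le le sm r(1))
      then have "sqrt (\<Sum>k. (g z (Suc k) - f0 (Suc k))\<^sup>2) < sqrt (\<rho>\<^sup>2)"
        using r(2) by (intro real_sqrt_less_mono) auto
      then show "z \<in> g -` S \<inter> space N"
        using z(1) sm \<open>\<rho> > 0\<close> measurable_space[OF g z(1)]
        by (auto simp: S_def square_summable_def l2_norm_def)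
    qed
  qed
  also have "\<dots> = measure (distr N T g) S"
    using g S by (simp add: measure_distr)
  also have "\<dots> = small_ball_prob (series_prior \<sigma> h) f0 \<rho>"
    by (simp add: small_ball_prob_def prior S_def)
  finally show ?thesis .
qed

section \<open>Sums over head and tail indices\<close>

text \<open>Comparison with a telescoping series: by the mean value theorem
  \<open>x powr (- 1 - \<eta>)\<close> is at most a constant times the decrease of
  \<open>x powr (- \<eta>)\<close> over a unit step.\<close>

lemma powr_tail_sum_le:
  fixes \<eta> Y :: real
  assumes "\<eta> > 0" "Y > 0"
  defines "t \<equiv> (\<lambda>k. if Y < real (Suc k) then real (Suc k) powr (- 1 - \<eta>) else 0)"
  shows "summable t" "suminf t \<le> 2 powr (1 + \<eta>) / \<eta> * Y powr (- \<eta>)"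
proof -
  define C where "C = 2 powr (1 + \<eta>) / \<eta>"
  have "C > 0" using assms by (simp add: C_def)
  \<comment> \<open>The minimum keeps \<open>u\<close> constant as long as the index does not exceed
    the cutoff, where the terms of \<open>t\<close> vanish. The telescoped total is
    \<open>u 0\<close>, hence at most \<open>C * Y powr (- \<eta>)\<close>, also when
    \<open>Y < 1\<close>.\<close>
  define u where "u k = C * min (Y powr (- \<eta>)) (real (Suc k) powr (- \<eta>))" for k
  have step: "x powr (- 1 - \<eta>) \<le> C * (x powr (- \<eta>) - (x + 1) powr (- \<eta>))" if "x \<ge> 1" for x
  proof -
    have "\<exists>z>x. z < x + 1 \<and> (x + 1) powr (- \<eta>) - x powr (- \<eta>) = (x + 1 - x) * (- \<eta> * z powr (- \<eta> - 1))"
      by (rule MVT2) (use that in \<open>auto intro!: derivative_eq_intros simp: powr_diff\<close>)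
    then obtain z where z: "x < z" "z < x + 1"
      "x powr (- \<eta>) - (x + 1) powr (- \<eta>) = \<eta> * z powr (- \<eta> - 1)"
      by auto
    \<comment> \<open>Since \<open>z < x + 1 \<le> 2 * x\<close>, replacing \<open>x\<close> by
      \<open>z\<close> costs the factor \<open>2 powr (1 + \<eta>)\<close> in
      \<open>C\<close>.\<close>
    have "x powr (- 1 - \<eta>) = 2 powr (1 + \<eta>) * (2 * x) powr (- 1 - \<eta>)"
      using that by (simp add: powr_mult flip: powr_add mult.assoc)
    also have "\<dots> \<le> 2 powr (1 + \<eta>) * z powr (- 1 - \<eta>)"
      using that z \<open>\<eta> > 0\<close> by (intro mult_left_mono powr_mono2') auto
    also have "\<dots> = C * (x powr (- \<eta>) - (x + 1) powr (- \<eta>))"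
      using \<open>\<eta> > 0\<close> by (simp add: z C_def minus_diff_commute)
    finally show ?thesis .
  qed
  have le: "t k \<le> u k - u (Suc k)" for k
  proof (cases "Y < real (Suc k)")
    case True
    have "real (Suc k) powr (- \<eta>) \<le> Y powr (- \<eta>)" "real (Suc (Suc k)) powr (- \<eta>) \<le> Y powr (- \<eta>)"
      using True \<open>\<eta> > 0\<close> \<open>Y > 0\<close> by (auto intro!: powr_mono2')
    then have "u k - u (Suc k) = C * (real (Suc k) powr (- \<eta>) - (real (Suc k) + 1) powr (- \<eta>))"
      by (simp add: u_def min_absorb2 algebra_simps)
    then show ?thesis using True step[of "real (Suc k)"] by (simp add: t_def)
  next
    case False
    have "real (Suc (Suc k)) powr (- \<eta>) \<le> real (Suc k) powr (- \<eta>)"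
      using \<open>\<eta> > 0\<close> by (intro powr_mono2') auto
    then have "u (Suc k) \<le> u k"
      unfolding u_def using \<open>C > 0\<close> by (intro mult_left_mono min.mono) auto
    then show ?thesis using False by (simp add: t_def)
  qed
  have "(\<lambda>k. real (Suc k) powr (- \<eta>)) \<longlonglongrightarrow> 0"
    using \<open>\<eta> > 0\<close>
    by (intro tendsto_neg_powr filterlim_compose[OF filterlim_real_sequentially filterlim_Suc]) auto
  then have "u \<longlonglongrightarrow> C * min (Y powr (- \<eta>)) 0"
    unfolding u_def by (intro tendsto_intros)
  then have u: "(\<lambda>k. u k - u (Suc k)) sums u 0"
    using telescope_sums'[of u 0] by simp
  show "summable t"
    by (rule summable_comparison_test'[OF sums_summable[OF u], of 0])
       (use le in \<open>auto simp: t_def\<close>)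
  then have "suminf t \<le> u 0"
    using suminf_le[OF le _ sums_summable[OF u]] sums_unique[OF u] by simp
  also have "\<dots> \<le> C * Y powr (- \<eta>)"
    using \<open>C > 0\<close> by (simp add: u_def)
  finally show "suminf t \<le> 2 powr (1 + \<eta>) / \<eta> * Y powr (- \<eta>)"
    by (simp add: C_def)
qed

text \<open>The number of head indices is the integer part of \<open>Y\<close>, so no additive
  rounding term appears. This matters because the cutoff may lie below 1, where the head is
  empty.\<close>

lemma const_head_sum_le:
  fixes A Y :: real
  assumes "A \<ge> 0" "Y \<ge> 0"
  defines "t \<equiv> (\<lambda>k. if Y < real (Suc k) then 0 else A)"
  shows "summable t" "suminf t \<le> A * Y"
proof -
  have "(\<lambda>k. if k \<in> {..<nat \<lfloor>Y\<rfloor>} then A else 0) sums (\<Sum>k<nat \<lfloor>Y\<rfloor>. A)"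
    by (rule sums_If_finite_set) simp
  moreover have "(\<lambda>k. if k \<in> {..<nat \<lfloor>Y\<rfloor>} then A else 0) = t"
  proof
    fix k
    have "Y < real (Suc k) \<longleftrightarrow> \<not> k < nat \<lfloor>Y\<rfloor>"
      using \<open>Y \<ge> 0\<close> by linarith
    then show "(if k \<in> {..<nat \<lfloor>Y\<rfloor>} then A else 0) = t k" by (simp add: t_def)
  qed
  ultimately have t: "t sums (real (nat \<lfloor>Y\<rfloor>) * A)" by simp
  show "summable t" using t by (rule sums_summable)
  have "real (nat \<lfloor>Y\<rfloor>) \<le> Y" using \<open>Y \<ge> 0\<close> by simp
  then show "suminf t \<le> A * Y"
    using sums_unique[OF t] \<open>A \<ge> 0\<close> mult_right_mono by (metis mult.commute)
qed

text \<open>Beyond the cutoff every Sobolev weight is at least \<open>Y powr (2 * \<beta>)\<close>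
  and can be divided out. This controls the squared bias from the high coefficients.\<close>

lemma sobolev_ball_tail_le:
  assumes "f \<in> sobolev_ball \<beta> L" "\<beta> > 0" "Y > 0"
  defines "t \<equiv> (\<lambda>k. if Y < real (Suc k) then (f (Suc k))\<^sup>2 else 0)"
  shows "summable t" "suminf t \<le> Y powr (- 2 * \<beta>) * L\<^sup>2"
proof -
  define s where "s k = real (Suc k) powr (2 * \<beta>) * (f (Suc k))\<^sup>2" for k
  have s: "summable s" "suminf s \<le> L\<^sup>2"
    using assms(1) by (simp_all add: sobolev_ball_def s_def [abs_def])
  have le: "t k \<le> Y powr (- 2 * \<beta>) * s k" for k
  proof (cases "Y < real (Suc k)")
    case True
    have "1 = Y powr (- 2 * \<beta>) * Y powr (2 * \<beta>)"
      using \<open>Y > 0\<close> by (simp flip: powr_add)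
    also have "\<dots> \<le> Y powr (- 2 * \<beta>) * real (Suc k) powr (2 * \<beta>)"
      using True assms by (intro mult_left_mono powr_mono2) auto
    finally have "1 * (f (Suc k))\<^sup>2 \<le> (Y powr (- 2 * \<beta>) * real (Suc k) powr (2 * \<beta>)) * (f (Suc k))\<^sup>2"
      by (rule mult_right_mono) simp
    then show ?thesis using True by (simp add: t_def s_def mult.assoc)
  qed (auto simp: t_def s_def)
  show "summable t"
    by (rule summable_comparison_test'[OF summable_mult[OF s(1), of "Y powr (- 2 * \<beta>)"], of 0])
       (use le in \<open>simp add: t_def\<close>)
  then have "suminf t \<le> (\<Sum>k. Y powr (- 2 * \<beta>) * s k)"
    by (intro suminf_le le summable_mult s)
  also have "\<dots> = Y powr (- 2 * \<beta>) * suminf s"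
    by (rule suminf_mult[OF s(1)])
  also have "\<dots> \<le> Y powr (- 2 * \<beta>) * L\<^sup>2"
    using s(2) by (intro mult_left_mono) auto
  finally show "suminf t \<le> Y powr (- 2 * \<beta>) * L\<^sup>2" .
qed

lemma sobolev_ball_abs_le:
  assumes "f \<in> sobolev_ball \<beta> L" "\<beta> > 0" "L > 0" "k \<ge> 1"
  shows "\<bar>f k\<bar> \<le> L"
proof -
  obtain j where j: "k = Suc j" using \<open>k \<ge> 1\<close> by (cases k) auto
  define s where "s k = real (Suc k) powr (2 * \<beta>) * (f (Suc k))\<^sup>2" for k
  have s: "summable s" "suminf s \<le> L\<^sup>2"
    using assms(1) by (simp_all add: sobolev_ball_def s_def [abs_def])
  have "1 * (f k)\<^sup>2 \<le> real k powr (2 * \<beta>) * (f k)\<^sup>2"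
    using assms by (intro mult_right_mono ge_one_powr_ge_zero) auto
  also have "\<dots> = sum s {j}" by (simp add: j s_def)
  also have "\<dots> \<le> suminf s" by (intro sum_le_suminf s) (auto simp: s_def)
  also have "\<dots> \<le> L\<^sup>2" by (rule s)
  finally have "(f k)\<^sup>2 \<le> L\<^sup>2" by simp
  then show ?thesis using \<open>L > 0\<close> abs_le_square_iff[of "f k" L] by simp
qed

section \<open>Probabilities of single-coordinate constraints\<close>

locale heavy_tailed_density =
  fixes h :: "real \<Rightarrow> real" and c1 c2 \<kappa> :: real
  assumes density: "probability_density h"
    and symmetric: "h (- x) = h x"
    and positive: "h x > 0"
    and decreasing: "antimono_on {0..} h"
    and c1: "c1 > 0" and kappa: "\<kappa> \<ge> 0"
    and log_bound: "x \<ge> 0 \<Longrightarrow> ln (1 / h x) \<le> c1 * (1 + ln (1 + x) powr (1 + \<kappa>))"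
    and c2: "c2 > 0"
    and tail_bound: "x \<ge> 1 \<Longrightarrow> (LBINT u:{x..}. h u) \<le> c2 / x\<^sup>2"
begin

abbreviation law :: "real measure" where
  "law \<equiv> density lborel (\<lambda>x. ennreal (h x))"

lemma abs_antimono: "\<bar>x\<bar> \<le> \<bar>y\<bar> \<Longrightarrow> h y \<le> h x"
  using monotone_onD[OF decreasing, of "\<bar>x\<bar>" "\<bar>y\<bar>"] symmetric[of x] symmetric[of y]
  by (auto simp: abs_if split: if_splits)

text \<open>The event contains the interval of radius \<open>w\<close> around \<open>f / s\<close>.
  Its points have modulus at most \<open>\<bar>f / s\<bar> + w\<close>, and \<open>h\<close>
  decreases in the modulus.\<close>

lemma prob_interval_ge:
  assumes "s > 0" "w \<ge> 0" "s * w \<le> r"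
  shows "2 * w * h (\<bar>f / s\<bar> + w) \<le> measure law {x. \<bar>s * x - f\<bar> \<le> r}"
proof -
  interpret prob_space law by (rule prob_space_density_lborel[OF density])
  define J where "J = {f / s - w .. f / s + w}"
  have "integrable lborel h" using density by (simp add: probability_density_def)
  then have int: "set_integrable lborel J h"
    unfolding set_integrable_def J_def by (intro integrable_mult_indicator) auto
  have "2 * w * h (\<bar>f / s\<bar> + w) = (LBINT x:J. h (\<bar>f / s\<bar> + w))"
    using \<open>w \<ge> 0\<close> by (simp add: J_def set_lebesgue_integral_def)
  also have "\<dots> \<le> (LBINT x:J. h x)"
  proof (rule set_integral_mono[OF _ int])
    show "set_integrable lborel J (\<lambda>x. h (\<bar>f / s\<bar> + w))"
      unfolding J_def by (intro borel_integrable_atLeastAtMost' continuous_intros)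
    show "h (\<bar>f / s\<bar> + w) \<le> h x" if "x \<in> J" for x
      using that by (intro abs_antimono) (auto simp: J_def simp del: abs_divide)
  qed
  also have "\<dots> = measure law J"
    by (simp add: measure_density_lborel[OF density] J_def)
  also have "\<dots> \<le> measure law {x. \<bar>s * x - f\<bar> \<le> r}"
  proof (rule finite_measure_mono)
    show "J \<subseteq> {x. \<bar>s * x - f\<bar> \<le> r}"
    proof
      fix x assume "x \<in> J"
      then have "\<bar>x - f / s\<bar> \<le> w" by (auto simp: J_def)
      then have "s * \<bar>x - f / s\<bar> \<le> s * w" using \<open>s > 0\<close> by (intro mult_left_mono) auto
      moreover have "s * \<bar>x - f / s\<bar> = \<bar>s * x - f\<bar>"
        using \<open>s > 0\<close> abs_mult[of s "x - f / s"] by (simp add: right_diff_distrib)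
      ultimately show "x \<in> {x. \<bar>s * x - f\<bar> \<le> r}" using assms(3) by simp
    qed
  qed measurable
  finally show ?thesis .
qed

lemma prob_abs_le_ge:
  assumes "t \<ge> 1"
  shows "1 - 2 * c2 / t\<^sup>2 \<le> measure law {x. \<bar>x\<bar> \<le> t}"
proof -
  interpret prob_space law by (rule prob_space_density_lborel[OF density])
  have tail: "measure law {t..} \<le> c2 / t\<^sup>2"
    using tail_bound[OF assms] by (simp add: measure_density_lborel[OF density])
  have "(LBINT x:{..-t}. h x) = (LBINT x:{t..}. h x)"
    by (subst set_integral_reflect) (simp add: symmetric atLeast_def)
  then have tail': "measure law {..-t} \<le> c2 / t\<^sup>2"
    using tail by (simp add: measure_density_lborel[OF density])
  have "1 - measure law {x. \<bar>x\<bar> \<le> t} = measure law (space law - {x. \<bar>x\<bar> \<le> t})"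
    by (subst prob_compl) auto
  also have "\<dots> \<le> measure law ({t..} \<union> {..-t})"
    by (intro finite_measure_mono) auto
  also have "\<dots> \<le> measure law {t..} + measure law {..-t}"
    by (intro measure_Un_le) auto
  finally show ?thesis using tail tail' by simp
qed

text \<open>Origin of the exponent \<gamma>. In the application \<open>y\<close> is
  \<open>ln k\<close>, \<open>u\<close> is proportional to \<open>ln n\<close> and \<open>x\<close>
  is \<open>f0 k / \<sigma> k\<close>: the logarithm of \<open>2 + \<bar>x\<bar>\<close> is of order
  at most \<open>u powr (1 + \<delta>)\<close>, and the bound on \<open>h\<close> raises this to the
  power \<open>1 + \<kappa>\<close>. The shift by 1 leaves room for an interval around
  \<open>x\<close>.\<close>

lemma neg_ln_density_le:
  fixes a C \<delta> L :: real
  assumes "a \<ge> 0" "C \<ge> 1" "\<delta> \<ge> 0" "L \<ge> 0"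
  obtains C' where "C' > 0"
    "\<And>u y x. u \<ge> 1 \<Longrightarrow> 0 \<le> y \<Longrightarrow> y \<le> C * u \<Longrightarrow> \<bar>x\<bar> \<le> L * exp (a * (1 + y powr (1 + \<delta>))) \<Longrightarrow>
      ln (1 / h (\<bar>x\<bar> + 1)) \<le> C' * u powr ((1 + \<kappa>) * (1 + \<delta>))"
proof -
  \<comment> \<open>Read off from the logarithm of
    \<open>(2 + L) * exp (a * (1 + y powr (1 + \<delta>)))\<close>, with
    \<open>y \<le> C * u\<close> and \<open>1 \<le> u powr (1 + \<delta>)\<close> absorbing the
    constants.\<close>
  define C1 where "C1 = ln (2 + L) + a * (1 + C powr (1 + \<delta>))"
  have "C1 \<ge> 0" using assms by (simp add: C1_def)
  have "ln (1 / h (\<bar>x\<bar> + 1)) \<le> c1 * (1 + C1 powr (1 + \<kappa>)) * u powr ((1 + \<kappa>) * (1 + \<delta>))"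
    if u: "u \<ge> 1" and y: "0 \<le> y" "y \<le> C * u" and x: "\<bar>x\<bar> \<le> L * exp (a * (1 + y powr (1 + \<delta>)))" for u y x
  proof -
    have u1: "1 \<le> u powr (1 + \<delta>)"
      using u \<open>\<delta> \<ge> 0\<close> by (intro ge_one_powr_ge_zero) auto
    have "y powr (1 + \<delta>) \<le> (C * u) powr (1 + \<delta>)"
      using y \<open>\<delta> \<ge> 0\<close> by (intro powr_mono2) auto
    also have "\<dots> = C powr (1 + \<delta>) * u powr (1 + \<delta>)"
      using assms u by (simp add: powr_mult)
    finally have yp: "y powr (1 + \<delta>) \<le> C powr (1 + \<delta>) * u powr (1 + \<delta>)" .
    have e1: "1 \<le> exp (a * (1 + y powr (1 + \<delta>)))"
      using \<open>a \<ge> 0\<close> by (simp add: add_nonneg_nonneg)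
    have "2 + \<bar>x\<bar> \<le> 2 * exp (a * (1 + y powr (1 + \<delta>))) + L * exp (a * (1 + y powr (1 + \<delta>)))"
      using e1 x by linarith
    then have "ln (2 + \<bar>x\<bar>) \<le> ln ((2 + L) * exp (a * (1 + y powr (1 + \<delta>))))"
      by (subst ln_le_cancel_iff) (use \<open>L \<ge> 0\<close> in \<open>auto simp: algebra_simps intro: add_pos_nonneg\<close>)
    also have "\<dots> = ln (2 + L) * 1 + a * (1 + y powr (1 + \<delta>))"
      using \<open>L \<ge> 0\<close> by (simp add: ln_mult)
    also have "\<dots> \<le> ln (2 + L) * u powr (1 + \<delta>) + a * (u powr (1 + \<delta>) + C powr (1 + \<delta>) * u powr (1 + \<delta>))"
      using u1 yp assms by (intro add_mono mult_left_mono) auto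
    also have "\<dots> = C1 * u powr (1 + \<delta>)"
      by (simp add: C1_def algebra_simps)
    finally have "ln (2 + \<bar>x\<bar>) powr (1 + \<kappa>) \<le> (C1 * u powr (1 + \<delta>)) powr (1 + \<kappa>)"
      using kappa by (intro powr_mono2) auto
    also have "\<dots> = C1 powr (1 + \<kappa>) * u powr ((1 + \<kappa>) * (1 + \<delta>))"
      using \<open>C1 \<ge> 0\<close> u by (simp add: powr_mult powr_powr mult.commute)
    finally have l: "ln (2 + \<bar>x\<bar>) powr (1 + \<kappa>) \<le> C1 powr (1 + \<kappa>) * u powr ((1 + \<kappa>) * (1 + \<delta>))" .
    have u2: "1 \<le> u powr ((1 + \<kappa>) * (1 + \<delta>))"
      using u \<open>\<delta> \<ge> 0\<close> kappa by (intro ge_one_powr_ge_zero) auto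
    have "ln (1 / h (\<bar>x\<bar> + 1)) \<le> c1 * (1 + ln (2 + \<bar>x\<bar>) powr (1 + \<kappa>))"
      using log_bound[of "\<bar>x\<bar> + 1"] by (simp add: add_ac)
    also have "\<dots> \<le> c1 * (u powr ((1 + \<kappa>) * (1 + \<delta>)) + C1 powr (1 + \<kappa>) * u powr ((1 + \<kappa>) * (1 + \<delta>)))"
      using c1 l u2 by (intro mult_left_mono add_mono) auto
    finally show ?thesis by (simp add: algebra_simps)
  qed
  moreover have "c1 * (1 + C1 powr (1 + \<kappa>)) > 0"
    using c1 by (intro mult_pos_pos add_pos_nonneg) auto
  ultimately show ?thesis using that by blast
qed

text \<open>The head constraint: the radius is the \<open>\<epsilon> / sqrt X\<close> of the
  overview, because \<open>n * \<epsilon>\<^sup>2 = X * ln n powr \<gamma>\<close>. An interval of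
  radius of order \<open>1 / n\<close> fits, and its length costs only \<open>ln n\<close> plus a
  constant in the exponent, which is absorbed because \<open>\<gamma> \<ge> 1\<close>. The condition
  on \<open>k\<close> keeps \<open>ln k\<close> of order \<open>ln n\<close>.\<close>

lemma prob_coordinate_ge:
  fixes a \<delta> C B L :: real and \<sigma> f0 :: "nat \<Rightarrow> real"
  assumes pos: "a \<ge> 0" "\<delta> \<ge> 0" "C > 0" "B \<ge> 1" "L > 0"
    and \<sigma>_le: "\<And>k. k \<ge> 1 \<Longrightarrow> \<sigma> k \<le> C"
    and \<sigma>_ge: "\<And>k. k \<ge> 1 \<Longrightarrow> exp (- a * (1 + ln (real k) powr (1 + \<delta>))) \<le> \<sigma> k"
    and f0: "\<And>k. k \<ge> 1 \<Longrightarrow> \<bar>f0 k\<bar> \<le> L"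
  defines "\<gamma> \<equiv> (1 + \<kappa>) * (1 + \<delta>)"
  obtains C' where "C' > 0"
    "\<And>n k. n \<ge> 2 \<Longrightarrow> k \<ge> 1 \<Longrightarrow> real k \<le> B * real n \<Longrightarrow>
      exp (- C' * ln (real n) powr \<gamma>) \<le>
        measure law {x. \<bar>\<sigma> k * x - f0 k\<bar> \<le> sqrt (ln (real n) powr \<gamma> / real n)}"
proof -
  have \<gamma>: "\<gamma> \<ge> 1"
    unfolding \<gamma>_def using mult_mono[of 1 "1 + \<kappa>" 1 "1 + \<delta>"] kappa pos by simp
  obtain C1 where C1: "C1 > 0"
    "\<And>u y x. u \<ge> 1 \<Longrightarrow> 0 \<le> y \<Longrightarrow> y \<le> (ln B + 1) * u \<Longrightarrow>
      \<bar>x\<bar> \<le> L * exp (a * (1 + y powr (1 + \<delta>))) \<Longrightarrow> ln (1 / h (\<bar>x\<bar> + 1)) \<le> C1 * u powr \<gamma>"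
    unfolding \<gamma>_def by (rule neg_ln_density_le[of a "ln B + 1" \<delta> L]) (use pos in auto)
  \<comment> \<open>Chosen so that \<open>\<sigma> k * b / n\<close> stays below the allowed radius
    for every \<open>n \<ge> 2\<close>, using \<open>\<sigma> k \<le> C\<close> and
    \<open>1 / n \<le> sqrt (1 / n)\<close>; \<open>b \<le> 1\<close> keeps the interval radius
    \<open>b / n\<close> below 1.\<close>
  define b where "b = min 1 (sqrt (ln 2 powr \<gamma>) / C)"
  have b: "0 < b" "b \<le> 1" "C * b \<le> sqrt (ln 2 powr \<gamma>)"
  proof -
    show "0 < b" "b \<le> 1" using \<open>C > 0\<close> by (auto simp: b_def)
    have "C * b \<le> C * (sqrt (ln 2 powr \<gamma>) / C)"
      using \<open>C > 0\<close> by (intro mult_left_mono) (auto simp: b_def)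
    then show "C * b \<le> sqrt (ln 2 powr \<gamma>)" using \<open>C > 0\<close> by simp
  qed
  define C2 where "C2 = 1 - ln b + C1"
  have "C2 > 0" using b(1) C1(1) ln_le_zero_iff[of b] b(2) unfolding C2_def by linarith
  have main: "exp (- (C2 / ln 2 powr \<gamma>) * ln (real n) powr \<gamma>) \<le>
        measure law {x. \<bar>\<sigma> k * x - f0 k\<bar> \<le> sqrt (ln (real n) powr \<gamma> / real n)}"
    if n: "n \<ge> 2" and k: "k \<ge> 1" "real k \<le> B * real n" for n k :: nat
  proof -
    \<comment> \<open>Normalised so that \<open>u \<ge> 1\<close> already at \<open>n = 2\<close>;
      constants are then bounded by multiples of \<open>u powr \<gamma>\<close>.\<close>
    define u where "u = ln (real n) / ln 2"
    have ln_n: "ln 2 \<le> ln (real n)" using n by simp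
    then have u: "u \<ge> 1" by (simp add: u_def)
    have "ln (real n) * ln 2 \<le> ln (real n) * 1"
      using n ln_2_less_1 by (intro mult_left_mono) auto
    then have ln_u: "ln (real n) \<le> u" by (simp add: u_def pos_le_divide_eq)
    have u_powr: "1 \<le> u powr \<gamma>" "u \<le> u powr \<gamma>"
      using u \<gamma> powr_mono[of 1 \<gamma> u] by (auto intro: ge_one_powr_ge_zero)
    define x where "x = f0 k / \<sigma> k"
    have \<sigma>: "\<sigma> k > 0" using \<sigma>_ge[OF k(1)] by (rule less_le_trans[OF exp_gt_zero])
    have "ln (real k) \<le> ln (B * real n)" using k by (subst ln_le_cancel_iff) (use pos n in auto)
    also have "\<dots> = ln B * 1 + ln (real n)" using pos n by (simp add: ln_mult)
    also have "\<dots> \<le> ln B * u + u" using u ln_u pos by (intro add_mono mult_left_mono) auto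
    finally have ln_k: "ln (real k) \<le> (ln B + 1) * u" by (simp add: algebra_simps)
    have "\<bar>x\<bar> = \<bar>f0 k\<bar> * inverse (\<sigma> k)" using \<sigma> by (simp add: x_def divide_inverse abs_mult)
    also have "\<dots> \<le> L * inverse (exp (- a * (1 + ln (real k) powr (1 + \<delta>))))"
      using f0[OF k(1)] \<sigma>_ge[OF k(1)] \<sigma> pos by (intro mult_mono le_imp_inverse_le) auto
    finally have "\<bar>x\<bar> \<le> L * exp (a * (1 + ln (real k) powr (1 + \<delta>)))"
      by (simp flip: exp_minus)
    then have ln_h: "ln (1 / h (\<bar>x\<bar> + 1)) \<le> C1 * u powr \<gamma>"
      using u ln_k k(1) by (intro C1(2)) auto
    define w where "w = b / real n"
    have w: "0 < w" "w \<le> 1" using b n by (auto simp: w_def divide_le_eq)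
    have "ln (1 / w) = ln (real n) + (- ln b) * 1"
      using b n by (simp add: w_def ln_div)
    also have "\<dots> \<le> u powr \<gamma> + (- ln b) * u powr \<gamma>"
      using ln_u u_powr b by (intro add_mono mult_left_mono) auto
    finally have ln_w: "ln (1 / w) \<le> (1 - ln b) * u powr \<gamma>" by (simp add: algebra_simps)
    have "\<sigma> k * w \<le> C * w" using \<sigma>_le[OF k(1)] w by (intro mult_right_mono) auto
    also have "\<dots> = C * b * (1 / real n)" by (simp add: w_def)
    also have "\<dots> \<le> sqrt (ln 2 powr \<gamma>) * sqrt (1 / real n)"
    proof (intro mult_mono b)
      have "(1 / real n)\<^sup>2 \<le> 1 / real n"
        using n by (simp add: power2_eq_square divide_le_eq)
      then show "1 / real n \<le> sqrt (1 / real n)" by (rule real_le_rsqrt)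
    qed auto
    also have "\<dots> = sqrt (ln 2 powr \<gamma> / real n)"
      by (simp flip: real_sqrt_mult)
    also have "\<dots> \<le> sqrt (ln (real n) powr \<gamma> / real n)"
      using ln_n \<gamma> n by (intro real_sqrt_le_mono divide_right_mono powr_mono2) auto
    finally have \<sigma>_w: "\<sigma> k * w \<le> sqrt (ln (real n) powr \<gamma> / real n)" .
    have "C2 / ln 2 powr \<gamma> * ln (real n) powr \<gamma> = C2 * u powr \<gamma>"
      using n by (simp add: u_def powr_divide)
    also have "\<dots> \<ge> ln (1 / w) + ln (1 / h (\<bar>x\<bar> + 1))"
      using ln_w ln_h by (simp add: C2_def algebra_simps)
    also have "ln (1 / w) + ln (1 / h (\<bar>x\<bar> + 1)) = - ln (w * h (\<bar>x\<bar> + 1))"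
      using w positive[of "\<bar>x\<bar> + 1"] by (simp add: ln_div ln_mult)
    finally have "exp (- (C2 / ln 2 powr \<gamma>) * ln (real n) powr \<gamma>) \<le> exp (ln (w * h (\<bar>x\<bar> + 1)))"
      by simp
    also have "\<dots> = 1 * w * h (\<bar>x\<bar> + 1)" using w positive[of "\<bar>x\<bar> + 1"] by simp
    also have "\<dots> \<le> 2 * w * h (\<bar>x\<bar> + w)"
      using w less_imp_le[OF positive] by (intro mult_mono abs_antimono) auto
    also have "\<dots> \<le> measure law {x. \<bar>\<sigma> k * x - f0 k\<bar> \<le> sqrt (ln (real n) powr \<gamma> / real n)}"
      unfolding x_def using \<sigma> w \<sigma>_w by (intro prob_interval_ge) auto
    finally show ?thesis .
  qed
  show ?thesis
    by (rule that[OF _ main]) (use \<open>C2 > 0\<close> in auto)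
qed

end

text \<open>Puts \<open>1 - y\<close> in exponential form, so that infinitely many tail factors
  multiply to the exponential of a convergent sum.\<close>

lemma exp_neg_double_le:
  fixes y :: real
  assumes "0 \<le> y" "y \<le> 1/2"
  shows "exp (- (2 * y)) \<le> 1 - y"
proof -
  have "2 * y\<^sup>2 \<le> y"
    using mult_left_mono[of y "1/2" y] assms by (simp add: power2_eq_square)
  then have "- (2 * y) \<le> ln (1 - y)"
    using ln_one_minus_pos_lower_bound[of y] assms by simp
  then have "exp (- (2 * y)) \<le> exp (ln (1 - y))" by simp
  then show ?thesis using assms by simp
qed

context heavy_tailed_density
begin

text \<open>In the tail no shift towards the centre is needed:
  \<open>\<bar>s * x\<bar> \<le> r\<close> already puts \<open>s * x\<close> within
  \<open>r + \<bar>f\<bar>\<close> of \<open>f\<close>. The condition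
  \<open>4 * c2 \<le> t\<^sup>2\<close> makes the excluded probability at most 1/2, as the
  exponential form requires.\<close>

lemma prob_tail_coordinate_ge:
  assumes "t \<ge> 1" "4 * c2 \<le> t\<^sup>2" "0 < s" "s * t \<le> r"
  shows "exp (- (4 * c2 / t\<^sup>2)) \<le> measure law {x. \<bar>s * x - f\<bar> \<le> r + \<bar>f\<bar>}"
proof -
  interpret prob_space law by (rule prob_space_density_lborel[OF density])
  have "exp (- (4 * c2 / t\<^sup>2)) \<le> 1 - 2 * c2 / t\<^sup>2"
    using exp_neg_double_le[of "2 * c2 / t\<^sup>2"] assms c2 by (simp add: divide_le_eq)
  also have "\<dots> \<le> measure law {x. \<bar>x\<bar> \<le> t}"
    using assms by (intro prob_abs_le_ge)
  also have "\<dots> \<le> measure law {x. \<bar>s * x - f\<bar> \<le> r + \<bar>f\<bar>}"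
  proof (rule finite_measure_mono)
    show "{x. \<bar>x\<bar> \<le> t} \<subseteq> {x. \<bar>s * x - f\<bar> \<le> r + \<bar>f\<bar>}"
    proof
      fix x assume "x \<in> {x. \<bar>x\<bar> \<le> t}"
      then have "s * \<bar>x\<bar> \<le> s * t" using assms by (intro mult_left_mono) auto
      then have "\<bar>s * x\<bar> \<le> r" using assms abs_mult[of s x] by linarith
      then show "x \<in> {x. \<bar>s * x - f\<bar> \<le> r + \<bar>f\<bar>}" by simp
    qed
  qed measurable
  finally show ?thesis .
qed

section \<open>The small ball bound for an abstract effective dimension\<close>

text \<open>Here \<open>X n\<close> is any effective dimension tied to the rate by
  \<open>\<epsilon>_sq\<close>. \<open>X_le\<close> keeps head indices at most \<open>B * n\<close>,
  \<open>X_bias\<close> makes the truncation error of order \<epsilon>, and \<open>X_ge\<close>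
  allows surplus negative powers of \<open>X n\<close> to be bounded by constants. Only an upper and
  a lower bound on \<sigma> enter, so both scalings are covered.\<close>

lemma small_ball_prob_ge_exp:
  fixes \<alpha> \<beta> a \<delta> C B L x0 d2 :: real and \<sigma> f0 X \<epsilon> :: "nat \<Rightarrow> real"
  defines "\<gamma> \<equiv> (1 + \<kappa>) * (1 + \<delta>)"
  assumes \<alpha>: "\<alpha> > 1/2" and \<beta>: "0 < \<beta>" "\<beta> \<le> \<alpha>"
    and pos: "a \<ge> 0" "\<delta> \<ge> 0" "C > 0" "B \<ge> 1" "L > 0" "x0 > 0" "d2 > 0"
    and \<sigma>_le: "\<And>k. k \<ge> 1 \<Longrightarrow> \<sigma> k \<le> C * real k powr (- 1/2 - \<alpha>)"
    and \<sigma>_ge: "\<And>k. k \<ge> 1 \<Longrightarrow> exp (- a * (1 + ln (real k) powr (1 + \<delta>))) \<le> \<sigma> k"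
    and f0: "f0 \<in> sobolev_ball \<beta> L"
    and X_ge: "\<And>n. n \<ge> 2 \<Longrightarrow> x0 \<le> X n"
    and X_le: "\<And>n. n \<ge> 2 \<Longrightarrow> X n \<le> B * real n"
    and X_bias: "\<And>n. n \<ge> 2 \<Longrightarrow> X n powr (- 2 * \<beta>) \<le> B * (\<epsilon> n)\<^sup>2"
    and \<epsilon>_pos: "\<And>n. n \<ge> 2 \<Longrightarrow> \<epsilon> n > 0"
    and \<epsilon>_sq: "\<And>n. n \<ge> 2 \<Longrightarrow> real n * (\<epsilon> n)\<^sup>2 = X n * ln (real n) powr \<gamma>"
  obtains d1 where "d1 > 0"
    "\<And>n. n \<ge> 2 \<Longrightarrow>
      exp (- d2 * real n * (\<epsilon> n)\<^sup>2) \<le> small_ball_prob (series_prior \<sigma> h) f0 (d1 * \<epsilon> n)"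
proof -
  have \<sigma>_pos: "\<sigma> k > 0" if "k \<ge> 1" for k
    using \<sigma>_ge[OF that] by (rule less_le_trans[OF exp_gt_zero])
  have \<sigma>_le_C: "\<sigma> k \<le> C" if "k \<ge> 1" for k
  proof -
    have "real k powr (- 1/2 - \<alpha>) \<le> real k powr 0"
      using that \<alpha> by (intro powr_mono) auto
    then have "C * real k powr (- 1/2 - \<alpha>) \<le> C * 1"
      using pos that by (intro mult_left_mono) auto
    then show ?thesis using \<sigma>_le[OF that] by simp
  qed
  have f0_le: "\<bar>f0 k\<bar> \<le> L" if "k \<ge> 1" for k
    using f0 \<beta> pos that by (intro sobolev_ball_abs_le)
  obtain C' where C': "C' > 0"
    "\<And>n k. n \<ge> 2 \<Longrightarrow> k \<ge> 1 \<Longrightarrow> real k \<le> B * real n \<Longrightarrow>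
      exp (- C' * ln (real n) powr \<gamma>) \<le>
        measure law {x. \<bar>\<sigma> k * x - f0 k\<bar> \<le> sqrt (ln (real n) powr \<gamma> / real n)}"
    unfolding \<gamma>_def by (rule prob_coordinate_ge[OF pos(1-5) \<sigma>_le_C \<sigma>_ge f0_le]) auto
  \<comment> \<open>The head costs \<open>C' * l\<close> for each of at most \<open>c * X n\<close>
    coordinates, so this \<open>c\<close> spends at most half of the budget
    \<open>d2 * X n * l\<close>; \<open>c \<le> 1\<close> keeps the cutoff below
    \<open>X n\<close>.\<close>
  define c where "c = min 1 (d2 / (2 * C'))"
  have c: "0 < c" "c \<le> 1" "C' * c \<le> d2 / 2"
    using C' pos by (auto simp: c_def min_def field_simps)
  \<comment> \<open>Then \<open>1 + \<eta> = \<alpha> + 1/2\<close>, and both the tail costs and the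
    squared tail widths are multiples of \<open>k powr (- 1 - \<eta>)\<close>.\<close>
  define \<eta> where "\<eta> = \<alpha> - 1/2"
  have \<eta>: "\<eta> > 0" using \<alpha> by (simp add: \<eta>_def)
  define T where "T = 2 powr (1 + \<eta>) / \<eta>"
  have T: "T > 0" using \<eta> by (simp add: T_def)
  define l0 where "l0 = (ln 2 :: real) powr \<gamma>"
  have l0: "l0 > 0" by (simp add: l0_def)
  \<comment> \<open>The summands secure in turn \<open>t k \<ge> 1\<close>,
    \<open>4 * c2 \<le> (t k)\<^sup>2\<close>, and a total tail cost of at most the other half of
    the budget. The last uses \<open>l0\<close>, the value of \<open>ln n powr \<gamma>\<close> at
    \<open>n = 2\<close>.\<close>
  define M where "M = 1 + 4 * c2 + 8 * c2 * T / (d2 * l0)"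
  have "8 * c2 * T / (d2 * l0) > 0" using c2 T l0 pos by simp
  then have M: "M \<ge> 1" "M \<ge> 4 * c2" "8 * c2 * T / (d2 * l0) \<le> M"
    using c2 by (auto simp: M_def)
  have M': "4 * c2 * T / M \<le> d2 / 2 * l0"
    using M pos l0 by (simp add: field_simps)
  \<comment> \<open>In units of \<open>(\<epsilon> n)\<^sup>2\<close>: the head widths, the tail of
    the prior, and the bias of \<open>f0\<close>; the factors 2 come from squaring a sum.\<close>
  define E where "E = 1 + 2 * (C\<^sup>2 * M * T * c powr (- 2 * \<alpha>) * x0 powr (- (2 * \<alpha> - 2 * \<beta>)) * B)
    + 2 * (c powr (- 2 * \<beta>) * B * L\<^sup>2)"
  have "E > 0"
    unfolding E_def using M T pos by (intro add_pos_nonneg mult_nonneg_nonneg) auto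
  have main: "exp (- d2 * real n * (\<epsilon> n)\<^sup>2) \<le> small_ball_prob (series_prior \<sigma> h) f0 (sqrt (E + 1) * \<epsilon> n)"
    if n: "n \<ge> 2" for n
  proof -
    have X: "X n > 0" using X_ge[OF n] pos by simp
    define l where "l = ln (real n) powr \<gamma>"
    have "l0 \<le> l"
      unfolding l_def l0_def \<gamma>_def using n kappa pos by (intro powr_mono2) auto
    define Y where "Y = c * X n"
    have Y: "Y > 0" "Y \<le> X n" using c X by (auto simp: Y_def mult_le_cancel_right1)
    define t where "t k = sqrt (M * (real k / Y) powr (1 + \<eta>))" for k
    have t_sq: "(t k)\<^sup>2 = M * (real k / Y) powr (1 + \<eta>)" for k
      using M by (simp add: t_def)
    define s where "s k = C * real k powr (- 1/2 - \<alpha>) * t k" for k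
    define q where "q k = (if Y < real k then (4 * c2 / M * Y powr (1 + \<eta>)) * real k powr (- 1 - \<eta>) else C' * l)"
      for k
    define r where "r k = (if Y < real k then s k + \<bar>f0 k\<bar> else sqrt (l / real n))" for k
    have s_sq: "(s k)\<^sup>2 = (C\<^sup>2 * M * Y powr (- 1 - \<eta>)) * real k powr (- 1 - \<eta>)" if "k \<ge> 1" for k
    proof -
      have "(real k powr (- 1/2 - \<alpha>))\<^sup>2 = real k powr (- 2 - 2 * \<eta>)"
        using that by (simp add: \<eta>_def power2_eq_square flip: powr_add)
      moreover have "real k powr (- 2 - 2 * \<eta>) * (real k / Y) powr (1 + \<eta>)
          = Y powr (- 1 - \<eta>) * real k powr (- 1 - \<eta>)"
      proof -
        have "real k powr (- 2 - 2 * \<eta>) * real k powr (1 + \<eta>) = real k powr (- 1 - \<eta>)"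
          by (simp flip: powr_add)
        moreover have "inverse (Y powr (1 + \<eta>)) = Y powr (- 1 - \<eta>)"
          by (simp flip: powr_minus)
        moreover have "(real k / Y) powr (1 + \<eta>) = real k powr (1 + \<eta>) * inverse (Y powr (1 + \<eta>))"
          using Y by (subst powr_divide) (auto simp: divide_inverse)
        ultimately show ?thesis by (simp add: mult_ac)
      qed
      ultimately show ?thesis
        by (simp add: s_def power_mult_distrib t_sq mult_ac)
    qed
    have tail_sum: "summable (\<lambda>k. if Y < real (Suc k) then real (Suc k) powr (- 1 - \<eta>) else 0)"
      "(\<Sum>k. if Y < real (Suc k) then real (Suc k) powr (- 1 - \<eta>) else 0) \<le> T * Y powr (- \<eta>)"
      unfolding T_def using powr_tail_sum_le[OF \<eta> Y(1)] by auto
    have "exp (- (d2 * (X n * l))) \<le> small_ball_prob (series_prior \<sigma> h) f0 (sqrt (E + 1) * \<epsilon> n)"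
    proof (rule small_ball_prob_ge[OF density])
      show "exp (- q k) \<le> measure law {x. \<bar>\<sigma> k * x - f0 k\<bar> \<le> r k}" if k: "k \<ge> 1" for k
      proof (cases "Y < real k")
        case True
        have "1 * 1 \<le> (real k / Y) powr (1 + \<eta>)"
          using True Y \<eta> by (simp add: ge_one_powr_ge_zero)
        then have "M * 1 \<le> M * (real k / Y) powr (1 + \<eta>)"
          using M by (intro mult_left_mono) auto
        then have t_ge: "M \<le> (t k)\<^sup>2" by (simp add: t_sq)
        then have "1\<^sup>2 \<le> (t k)\<^sup>2" using M by simp
        then have "t k \<ge> 1"
          by (rule power2_le_imp_le) (use M in \<open>simp add: t_def\<close>)
        have "4 * c2 / (t k)\<^sup>2 = q k"
          using True Y k by (simp add: q_def t_sq powr_divide powr_diff powr_minus field_simps powr_add)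
        moreover have "\<sigma> k * t k \<le> s k"
          unfolding s_def using \<sigma>_le[OF k] \<open>t k \<ge> 1\<close> by (intro mult_right_mono) auto
        ultimately show ?thesis
          using prob_tail_coordinate_ge[of "t k" "\<sigma> k" "s k" "f0 k"] t_ge M \<open>t k \<ge> 1\<close> \<sigma>_pos[OF k] True
          by (simp add: r_def)
      next
        case False
        then have "real k \<le> B * real n" using Y X_le[OF n] by linarith
        then show ?thesis using C'(2)[OF n k] False by (simp add: q_def r_def l_def)
      qed
      show "0 \<le> q k" for k
        using C' c2 M by (auto simp: q_def l_def)
      have head: "summable (\<lambda>k. if Y < real (Suc k) then 0 else C' * l)"
        "(\<Sum>k. if Y < real (Suc k) then 0 else C' * l) \<le> C' * l * Y"
        by (rule const_head_sum_le; use C' Y in \<open>simp add: l_def\<close>)+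
      have q_eq: "q (Suc k) = (4 * c2 / M * Y powr (1 + \<eta>)) * (if Y < real (Suc k) then real (Suc k) powr (- 1 - \<eta>) else 0)
          + (if Y < real (Suc k) then 0 else C' * l)" for k
        by (simp add: q_def)
      show "summable (\<lambda>k. q (Suc k))"
        unfolding q_eq by (intro summable_add summable_mult tail_sum head)
      have "(\<Sum>k. q (Suc k)) = (4 * c2 / M * Y powr (1 + \<eta>)) * (\<Sum>k. if Y < real (Suc k) then real (Suc k) powr (- 1 - \<eta>) else 0)
          + (\<Sum>k. if Y < real (Suc k) then 0 else C' * l)"
        unfolding q_eq by (subst suminf_add[symmetric]) (simp_all only: summable_mult suminf_mult tail_sum head)
      also have "\<dots> \<le> (4 * c2 / M * Y powr (1 + \<eta>)) * (T * Y powr (- \<eta>)) + C' * l * Y"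
        using c2 M by (intro add_mono mult_left_mono tail_sum head) auto
      also have "\<dots> = 4 * c2 * T / M * Y + C' * c * l * X n"
        using Y by (simp add: powr_add powr_minus field_simps) (simp add: Y_def)
      \<comment> \<open>The tail cost is linear in \<open>Y\<close>, without a logarithm, so
        \<open>Y \<le> X n\<close> and \<open>l0 \<le> l\<close> suffice for its half; the choice of
        \<open>c\<close> gives the other.\<close>
      also have "\<dots> \<le> d2 / 2 * l * X n + d2 / 2 * l * X n"
      proof (rule add_mono)
        have "4 * c2 * T / M \<le> d2 / 2 * l"
          using M' mult_left_mono[OF \<open>l0 \<le> l\<close>, of "d2 / 2"] pos by linarith
        then show "4 * c2 * T / M * Y \<le> d2 / 2 * l * X n"
          using Y c2 T M pos by (intro mult_mono) (auto simp: l_def)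
        show "C' * c * l * X n \<le> d2 / 2 * l * X n"
          using c X by (intro mult_right_mono) (auto simp: l_def)
      qed
      finally show "(\<Sum>k. q (Suc k)) \<le> d2 * (X n * l)" by (simp add: mult_ac)
      define R where "R k = (2 * (C\<^sup>2 * M * Y powr (- 1 - \<eta>))) * (if Y < real (Suc k) then real (Suc k) powr (- 1 - \<eta>) else 0)
        + 2 * (if Y < real (Suc k) then (f0 (Suc k))\<^sup>2 else 0)
        + (if Y < real (Suc k) then 0 else l / real n)" for k
      have r_le: "(r (Suc k))\<^sup>2 \<le> R k" for k
      proof (cases "Y < real (Suc k)")
        case True
        have "(s (Suc k) + \<bar>f0 (Suc k)\<bar>)\<^sup>2 \<le> 2 * (s (Suc k))\<^sup>2 + 2 * (f0 (Suc k))\<^sup>2"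
          using zero_le_power2[of "s (Suc k) - \<bar>f0 (Suc k)\<bar>"]
          by (simp add: power2_diff power2_sum)
        then show ?thesis using True by (simp add: r_def R_def s_sq)
      qed (simp add: r_def R_def l_def)
      have bias: "summable (\<lambda>k. if Y < real (Suc k) then (f0 (Suc k))\<^sup>2 else 0)"
        "(\<Sum>k. if Y < real (Suc k) then (f0 (Suc k))\<^sup>2 else 0) \<le> Y powr (- 2 * \<beta>) * L\<^sup>2"
        using sobolev_ball_tail_le[OF f0 \<beta>(1) Y(1)] by auto
      have head': "summable (\<lambda>k. if Y < real (Suc k) then 0 else l / real n)"
        "(\<Sum>k. if Y < real (Suc k) then 0 else l / real n) \<le> l / real n * Y"
        by (rule const_head_sum_le; use Y in \<open>simp add: l_def\<close>)+
      have R: "summable R"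
        unfolding R_def by (intro summable_add summable_mult tail_sum bias head')
      show r_sum: "summable (\<lambda>k. (r (Suc k))\<^sup>2)"
        by (rule summable_comparison_test'[OF R, of 0]) (use r_le in simp)
      have Y_powr: "Y powr (- 2 * \<beta>) \<le> c powr (- 2 * \<beta>) * (B * (\<epsilon> n)\<^sup>2)"
        using c X X_bias[OF n] by (simp add: Y_def powr_mult mult_left_mono)
      \<comment> \<open>The prior tail is no larger in order than the bias since
        \<open>\<beta> \<le> \<alpha>\<close>: the surplus power of \<open>X n\<close> is
        nonpositive and is bounded by its value at \<open>x0\<close>.\<close>
      have "Y powr (- 2 * \<alpha>) = c powr (- 2 * \<alpha>) * (X n powr (- (2 * \<alpha> - 2 * \<beta>)) * X n powr (- 2 * \<beta>))"
        using c X by (simp add: Y_def powr_mult flip: powr_add)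
      also have "\<dots> \<le> c powr (- 2 * \<alpha>) * (x0 powr (- (2 * \<alpha> - 2 * \<beta>)) * (B * (\<epsilon> n)\<^sup>2))"
        using X_bias[OF n] X_ge[OF n] pos \<beta> by (intro mult_left_mono mult_mono powr_mono2') auto
      finally have Y_powr': "Y powr (- 2 * \<alpha>) \<le> c powr (- 2 * \<alpha>) * (x0 powr (- (2 * \<alpha> - 2 * \<beta>)) * (B * (\<epsilon> n)\<^sup>2))" .
      have "(\<Sum>k. (r (Suc k))\<^sup>2) \<le> suminf R"
        by (intro suminf_le r_le r_sum R)
      also have "\<dots> = (2 * (C\<^sup>2 * M * Y powr (- 1 - \<eta>))) * (\<Sum>k. if Y < real (Suc k) then real (Suc k) powr (- 1 - \<eta>) else 0)
        + 2 * (\<Sum>k. if Y < real (Suc k) then (f0 (Suc k))\<^sup>2 else 0)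
        + (\<Sum>k. if Y < real (Suc k) then 0 else l / real n)"
        unfolding R_def
        by (simp only: suminf_add[symmetric] suminf_mult[symmetric] summable_add summable_mult tail_sum(1) bias(1) head'(1))
      also have "\<dots> \<le> (2 * (C\<^sup>2 * M * Y powr (- 1 - \<eta>))) * (T * Y powr (- \<eta>)) + 2 * (Y powr (- 2 * \<beta>) * L\<^sup>2) + l / real n * Y"
        using M by (intro add_mono mult_left_mono tail_sum head' bias) auto
      also have "\<dots> = 2 * (C\<^sup>2 * M * T * Y powr (- 2 * \<alpha>)) + 2 * (Y powr (- 2 * \<beta>) * L\<^sup>2) + l / real n * Y"
      proof -
        have "Y powr (- 1 - \<eta>) * Y powr (- \<eta>) = Y powr (- 2 * \<alpha>)"
          by (simp add: \<eta>_def flip: powr_add)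
        then show ?thesis by (simp add: mult_ac)
      qed
      also have "\<dots> \<le> 2 * (C\<^sup>2 * M * T * (c powr (- 2 * \<alpha>) * (x0 powr (- (2 * \<alpha> - 2 * \<beta>)) * (B * (\<epsilon> n)\<^sup>2))))
        + 2 * ((c powr (- 2 * \<beta>) * (B * (\<epsilon> n)\<^sup>2)) * L\<^sup>2) + (\<epsilon> n)\<^sup>2"
      proof (intro add_mono mult_left_mono mult_right_mono Y_powr Y_powr')
        have "l / real n * Y \<le> l / real n * X n"
          using Y by (intro mult_left_mono) (auto simp: l_def)
        also have "\<dots> = (\<epsilon> n)\<^sup>2"
          using \<epsilon>_sq[OF n] n by (simp add: l_def field_simps)
        finally show "l / real n * Y \<le> (\<epsilon> n)\<^sup>2" .
      qed (use M T in auto)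
      also have "\<dots> = E * (\<epsilon> n)\<^sup>2" by (simp add: E_def algebra_simps)
      \<comment> \<open>The extra 1 supplies the strict inequality demanded by the open
        ball.\<close>
      also have "\<dots> < (E + 1) * (\<epsilon> n)\<^sup>2"
        using \<epsilon>_pos[OF n] by (intro mult_strict_right_mono) auto
      also have "\<dots> = (sqrt (E + 1) * \<epsilon> n)\<^sup>2"
        using \<open>E > 0\<close> by (simp add: power_mult_distrib)
      finally show "(\<Sum>k. (r (Suc k))\<^sup>2) < (sqrt (E + 1) * \<epsilon> n)\<^sup>2" .
      show "0 < sqrt (E + 1) * \<epsilon> n" using \<open>E > 0\<close> \<epsilon>_pos[OF n] by simp
    qed
    also have "- (d2 * (X n * l)) = - d2 * real n * (\<epsilon> n)\<^sup>2"
      using \<epsilon>_sq[OF n] by (simp add: l_def mult.assoc)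
    finally show ?thesis .
  qed
  show ?thesis
    by (rule that[OF _ main]) (use \<open>E > 0\<close> in auto)
qed

end

section \<open>Rates with a power of the logarithm\<close>

text \<open>The sequence tends to 0, hence is bounded over all \<open>n\<close>; no threshold on
  \<open>n\<close> enters the later constants.\<close>

lemma powr_mult_ln_powr_le:
  fixes s b :: real
  assumes "s < 0"
  obtains K where "K > 0" "\<And>n::nat. real n powr s * ln (real n) powr b \<le> K"
proof -
  have "(\<lambda>n::nat. real n powr s * ln (real n) powr b) \<longlonglongrightarrow> 0"
    using assms by real_asymp
  then have "Bseq (\<lambda>n::nat. real n powr s * ln (real n) powr b)"
    by (intro convergent_imp_Bseq convergentI)
  then obtain K where "K > 0" "\<And>n::nat. norm (real n powr s * ln (real n) powr b) \<le> K"
    by (auto simp: Bseq_def)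
  then show ?thesis using that[of K] by simp
qed

context heavy_tailed_density
begin

text \<open>Leaving the logarithmic exponent \<open>p\<close> free above a threshold treats both
  rates at once: the exponential scaling attains the threshold, while the polynomial rate exceeds it
  by \<open>1 / (2 * \<beta> + 1)\<close>.\<close>

lemma small_ball_prob_rate_ge:
  fixes \<alpha> \<beta> a \<delta> C L d2 p :: real and \<sigma> f0 :: "nat \<Rightarrow> real"
  defines "\<gamma> \<equiv> (1 + \<kappa>) * (1 + \<delta>)"
  defines "\<epsilon> \<equiv> \<lambda>n. ln (real n) powr p * real n powr (- \<beta> / (2 * \<beta> + 1))"
  assumes \<alpha>: "\<alpha> > 1/2" and \<beta>: "0 < \<beta>" "\<beta> \<le> \<alpha>" and p: "p \<ge> \<gamma> * \<beta> / (2 * \<beta> + 1)"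
    and pos: "a \<ge> 0" "\<delta> \<ge> 0" "C > 0" "L > 0" "d2 > 0"
    and \<sigma>_le: "\<And>k. k \<ge> 1 \<Longrightarrow> \<sigma> k \<le> C * real k powr (- 1/2 - \<alpha>)"
    and \<sigma>_ge: "\<And>k. k \<ge> 1 \<Longrightarrow> exp (- a * (1 + ln (real k) powr (1 + \<delta>))) \<le> \<sigma> k"
    and f0: "f0 \<in> sobolev_ball \<beta> L"
  shows "\<exists>d1>0. \<forall>n\<ge>2.
    exp (- d2 * real n * (\<epsilon> n)\<^sup>2) \<le> small_ball_prob (series_prior \<sigma> h) f0 (d1 * \<epsilon> n)"
proof -
  define \<theta> where "\<theta> = 1 / (2 * \<beta> + 1)"
  have \<theta>: "0 < \<theta>" "\<theta> < 1" "\<beta> * \<theta> * 2 = 1 - \<theta>" "\<beta> / (2 * \<beta> + 1) = \<beta> * \<theta>"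
    using \<beta> by (auto simp: \<theta>_def field_simps)
  \<comment> \<open>Obtained by solving
    \<open>n * \<epsilon>\<^sup>2 = X * ln n powr \<gamma>\<close>. The exponent
    \<open>2 * p - \<gamma>\<close> may be negative, so the lower bound \<open>1 / K1\<close> also
    needs a power of \<open>n\<close> to beat a power of the logarithm.\<close>
  define X where "X n = real n powr \<theta> * ln (real n) powr (2 * p - \<gamma>)" for n :: nat
  obtain K1 where K1: "K1 > 0" "\<And>n::nat. real n powr (- \<theta>) * ln (real n) powr (\<gamma> - 2 * p) \<le> K1"
    using powr_mult_ln_powr_le[of "- \<theta>"] \<theta> by auto
  obtain K2 where K2: "K2 > 0" "\<And>n::nat. real n powr (\<theta> - 1) * ln (real n) powr (2 * p - \<gamma>) \<le> K2"
    using powr_mult_ln_powr_le[of "\<theta> - 1"] \<theta> by auto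
  \<comment> \<open>Defined by \<open>X n powr (- 2 * \<beta>) = ln n powr (- m) * (\<epsilon>
    n)\<^sup>2\<close>; thus \<open>m \<ge> 0\<close>, which is the threshold on \<open>p\<close>,
    is what the bias condition needs.\<close>
  define m where "m = 2 * p + 2 * \<beta> * (2 * p - \<gamma>)"
  have "m = 2 * (2 * \<beta> + 1) * (p - \<gamma> * \<beta> / (2 * \<beta> + 1))"
    using \<beta> by (simp add: m_def field_simps)
  then have m: "m \<ge> 0" using p \<beta> by simp
  define K3 where "K3 = (ln 2 :: real) powr (- m)"
  define B where "B = max 1 (max K2 K3)"
  have B: "B \<ge> 1" "K2 \<le> B" "K3 \<le> B" by (auto simp: B_def)
  have \<epsilon>_sq': "(\<epsilon> n)\<^sup>2 = ln (real n) powr (2 * p) * real n powr (\<theta> - 1)" if "n \<ge> 2" for n :: nat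
  proof -
    have "(\<epsilon> n)\<^sup>2 = ln (real n) powr (p + p) * real n powr (- \<beta> / (2 * \<beta> + 1) + - \<beta> / (2 * \<beta> + 1))"
      unfolding powr_add by (simp add: \<epsilon>_def power2_eq_square mult_ac)
    also have "- \<beta> / (2 * \<beta> + 1) + - \<beta> / (2 * \<beta> + 1) = \<theta> - 1"
      using \<theta> by simp
    finally show ?thesis by simp
  qed
  have "\<exists>d1>0. \<forall>n\<ge>2. exp (- d2 * real n * (\<epsilon> n)\<^sup>2) \<le> small_ball_prob (series_prior \<sigma> h) f0 (d1 * \<epsilon> n)"
  proof (rule small_ball_prob_ge_exp[OF \<alpha> \<beta> pos(1-3) B(1) pos(4) _ pos(5) \<sigma>_le \<sigma>_ge f0, of "1 / K1" X \<epsilon>])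
    fix n :: nat assume n: "n \<ge> 2"
    then have l: "ln (real n) > 0" "ln 2 \<le> ln (real n)" by auto
    have X: "X n > 0" using n l by (simp add: X_def)
    have "1 / X n = real n powr (- \<theta>) * ln (real n) powr (- (2 * p - \<gamma>))"
      unfolding powr_minus X_def by (simp add: field_simps)
    then have "1 / X n \<le> K1" using K1(2)[of n] by simp
    then show "1 / K1 \<le> X n" using X K1(1) by (simp add: field_simps)
    have "X n = real n * (real n powr (\<theta> - 1) * ln (real n) powr (2 * p - \<gamma>))"
      using n by (simp add: X_def powr_diff)
    also have "\<dots> \<le> real n * B" using K2(2)[of n] B by (intro mult_left_mono) auto
    finally show "X n \<le> B * real n" by (simp add: mult.commute)
    show "\<epsilon> n > 0" using n l by (simp add: \<epsilon>_def)
    have "real n * (\<epsilon> n)\<^sup>2 = real n powr (1 + (\<theta> - 1)) * ln (real n) powr (2 * p)"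
      unfolding powr_add \<epsilon>_sq'[OF n] using n by simp
    also have "\<dots> = real n powr \<theta> * ln (real n) powr ((2 * p - \<gamma>) + \<gamma>)" by simp
    also have "\<dots> = X n * ln (real n) powr \<gamma>"
      unfolding powr_add X_def by (simp only: mult.assoc)
    finally show "real n * (\<epsilon> n)\<^sup>2 = X n * ln (real n) powr ((1 + \<kappa>) * (1 + \<delta>))"
      unfolding \<gamma>_def .
    have "X n powr (- 2 * \<beta>) = real n powr (\<theta> * (- 2 * \<beta>)) * ln (real n) powr ((2 * p - \<gamma>) * (- 2 * \<beta>))"
      using n l unfolding X_def by (subst powr_mult) (auto simp only: powr_powr powr_ge_zero)
    also have "\<theta> * (- 2 * \<beta>) = \<theta> - 1" using \<theta>(3) by (simp add: algebra_simps)
    also have "(2 * p - \<gamma>) * (- 2 * \<beta>) = - m + 2 * p" by (simp add: m_def algebra_simps)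
    also have "real n powr (\<theta> - 1) * ln (real n) powr (- m + 2 * p) = ln (real n) powr (- m) * (\<epsilon> n)\<^sup>2"
      unfolding powr_add \<epsilon>_sq'[OF n] by (simp add: mult_ac)
    also have "\<dots> \<le> B * (\<epsilon> n)\<^sup>2"
    proof (intro mult_right_mono)
      have "ln (real n) powr (- m) \<le> K3"
        unfolding K3_def using l m by (intro powr_mono2') auto
      then show "ln (real n) powr (- m) \<le> B" using B by simp
    qed simp
    finally show "X n powr (- 2 * \<beta>) \<le> B * (\<epsilon> n)\<^sup>2" .
  qed (use K1 in auto)
  then show ?thesis .
qed

end

section \<open>Exponential scaling, and the two cases of the theorem\<close>

text \<open>The power \<open>ln k powr (1 + \<delta>)\<close> outgrows every multiple of
  \<open>ln k\<close>, so the exponential scaling decays faster than any power of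
  \<open>k\<close>.\<close>

lemma exp_neg_ln_powr_le:
  fixes a \<delta> s :: real
  assumes "a > 0" "\<delta> > 0" "s \<ge> 0"
  obtains C where "C > 0" "\<And>k::nat. k \<ge> 1 \<Longrightarrow> exp (- a * ln (real k) powr (1 + \<delta>)) \<le> C * real k powr (- s)"
proof -
  \<comment> \<open>The point where \<open>a * y powr \<delta> = s\<close>: beyond it the
    superlinear term dominates \<open>s * y\<close>, and before it
    \<open>s * y \<le> s * y0\<close>.\<close>
  define y0 where "y0 = (s / a) powr (1 / \<delta>)"
  have "s * y \<le> s * y0 + a * y powr (1 + \<delta>)" if "y \<ge> 0" for y
  proof (cases "y \<le> y0")
    case True
    then have "s * y \<le> s * y0" using assms by (intro mult_left_mono)
    then show ?thesis using assms by (simp add: add_increasing2)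
  next
    case False
    moreover have "y0 \<ge> 0" by (simp add: y0_def)
    ultimately have y: "y > y0" "y0 \<ge> 0" "y > 0" by auto
    have "s / a = y0 powr \<delta>" using assms by (simp add: y0_def powr_powr)
    also have "\<dots> \<le> y powr \<delta>" using y assms by (intro powr_mono2) auto
    finally have "s \<le> a * y powr \<delta>" using assms by (simp add: divide_le_eq mult.commute)
    then have "s * y \<le> a * y powr \<delta> * y" using y by (intro mult_right_mono) auto
    also have "\<dots> = a * y powr (1 + \<delta>)" using y by (simp add: powr_add mult_ac)
    finally show ?thesis using assms y by (simp add: add_increasing)
  qed
  note y_bound = this
  have "exp (- a * ln (real k) powr (1 + \<delta>)) \<le> exp (s * y0) * real k powr (- s)" if "k \<ge> 1" for k :: nat
  proof -
    have "- a * ln (real k) powr (1 + \<delta>) \<le> s * y0 + (- s) * ln (real k)"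
      using y_bound[of "ln (real k)"] that by simp
    then have "exp (- a * ln (real k) powr (1 + \<delta>)) \<le> exp (s * y0 + (- s) * ln (real k))" by simp
    also have "\<dots> = exp (s * y0) * real k powr (- s)"
      using that by (simp only: exp_add) (simp add: powr_def)
    finally show ?thesis .
  qed
  then show ?thesis using that[of "exp (s * y0)"] by simp
qed

theorem theorem6:
  fixes h :: "real \<Rightarrow> real" and c1 c2 \<kappa> :: real
  assumes density: "probability_density h"
    and symmetric: "\<And>x. h (- x) = h x"
    and positive: "\<And>x. h x > 0"
    and bounded: "bounded (range h)"
    and decreasing: "antimono_on {0..} h"
    and c1: "c1 > 0" and kappa: "\<kappa> \<ge> 0"
    and log_bound: "\<And>x. x \<ge> 0 \<Longrightarrow> ln (1 / h x) \<le> c1 * (1 + ln (1 + x) powr (1 + \<kappa>))"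
    and c2: "c2 > 0"
    and tail_bound: "\<And>x. x \<ge> 1 \<Longrightarrow> (LBINT u:{x..}. h u) \<le> c2 / x\<^sup>2"
  shows
    "(\<forall>\<alpha> > 1/2. \<forall>\<beta> L f0. 0 < \<beta> \<longrightarrow> \<beta> \<le> \<alpha> \<longrightarrow> L > 0 \<longrightarrow> f0 \<in> sobolev_ball \<beta> L \<longrightarrow>
        (\<forall>d2 > 0. \<exists>d1 > 0. \<forall>n \<ge> 2.
           small_ball_prob (series_prior (\<lambda>k. real k powr (- 1/2 - \<alpha>)) h) f0 (d1 * rate_poly \<kappa> \<beta> n)
             \<ge> exp (- d2 * real n * (rate_poly \<kappa> \<beta> n)\<^sup>2)))
     \<and>
     (\<forall>a > 0. \<forall>\<delta> > 0. \<forall>\<beta> L f0. 0 < \<beta> \<longrightarrow> L > 0 \<longrightarrow> f0 \<in> sobolev_ball \<beta> L \<longrightarrow>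
        (\<forall>d2 > 0. \<exists>d1 > 0. \<forall>n \<ge> 2.
           small_ball_prob (series_prior (\<lambda>k. exp (- a * ln (real k) powr (1 + \<delta>))) h) f0
               (d1 * rate_exp \<kappa> \<delta> \<beta> n)
             \<ge> exp (- d2 * real n * (rate_exp \<kappa> \<delta> \<beta> n)\<^sup>2)))"
proof (intro conjI allI impI)
  interpret heavy_tailed_density h c1 c2 \<kappa>
    by unfold_locales fact+
  {
    fix \<alpha> \<beta> L d2 :: real and f0
    assume \<alpha>: "\<alpha> > 1/2" and \<beta>: "0 < \<beta>" "\<beta> \<le> \<alpha>" and L: "L > 0" "f0 \<in> sobolev_ball \<beta> L" and d2: "d2 > 0"
    show "\<exists>d1 > 0. \<forall>n \<ge> 2.
      small_ball_prob (series_prior (\<lambda>k. real k powr (- 1/2 - \<alpha>)) h) f0 (d1 * rate_poly \<kappa> \<beta> n)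
        \<ge> exp (- d2 * real n * (rate_poly \<kappa> \<beta> n)\<^sup>2)"
      unfolding rate_poly_def
    \<comment> \<open>The polynomial scaling is the case \<open>\<delta> = 0\<close> with
      \<open>C = 1\<close>; its lower bound has the required exponential form with
      \<open>a = 1/2 + \<alpha>\<close>, since
      \<open>k powr (- a) = exp (- a * ln k)\<close>.\<close>
    proof (rule small_ball_prob_rate_ge[OF \<alpha> \<beta> _ _ order.refl _ L(1) d2 _ _ L(2), of _ "1/2 + \<alpha>" 1])
      show "(1 + \<kappa>) * (1 + 0) * \<beta> / (2 * \<beta> + 1) \<le> (1 + (1 + \<kappa>) * \<beta>) / (2 * \<beta> + 1)"
        using \<beta> by (intro divide_right_mono) auto
      show "exp (- (1/2 + \<alpha>) * (1 + ln (real k) powr (1 + 0))) \<le> real k powr (- 1/2 - \<alpha>)" if "k \<ge> 1" for k :: nat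
        using that \<alpha> by (simp add: powr_def algebra_simps)
    qed (use \<alpha> in auto)
  next
    fix a \<delta> \<beta> L d2 :: real and f0
    assume a: "a > 0" "\<delta> > 0" and \<beta>: "0 < \<beta>" and L: "L > 0" "f0 \<in> sobolev_ball \<beta> L" and d2: "d2 > 0"
    \<comment> \<open>An auxiliary smoothness, absent from the statement: any value above 1/2 and at
      least \<beta> would serve, as the scaling is dominated by every power.\<close>
    define \<alpha> where "\<alpha> = max 1 \<beta>"
    have \<alpha>: "\<alpha> > 1/2" "\<beta> \<le> \<alpha>" by (auto simp: \<alpha>_def)
    obtain C where C: "C > 0"
      "\<And>k::nat. k \<ge> 1 \<Longrightarrow> exp (- a * ln (real k) powr (1 + \<delta>)) \<le> C * real k powr (- (1/2 + \<alpha>))"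
      using exp_neg_ln_powr_le[of a \<delta> "1/2 + \<alpha>"] a \<alpha> by auto
    show "\<exists>d1 > 0. \<forall>n \<ge> 2.
      small_ball_prob (series_prior (\<lambda>k. exp (- a * ln (real k) powr (1 + \<delta>))) h) f0 (d1 * rate_exp \<kappa> \<delta> \<beta> n)
        \<ge> exp (- d2 * real n * (rate_exp \<kappa> \<delta> \<beta> n)\<^sup>2)"
      unfolding rate_exp_def
    proof (rule small_ball_prob_rate_ge[OF \<alpha>(1) \<beta> \<alpha>(2) order.refl _ _ C(1) L(1) d2 _ _ L(2), of a])
      show "exp (- a * ln (real k) powr (1 + \<delta>)) \<le> C * real k powr (- 1/2 - \<alpha>)" if "k \<ge> 1" for k :: nat
        using C(2)[OF that] by (simp only: minus_add_distrib minus_divide_left add_uminus_conv_diff)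
    qed (use a in auto)
  }
qed

end
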